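(* Let $B_m$ be a bouquet of $m$ cycles $C^1,C^2,\ldots,C^m$ with a cut-vertex (i.e., the vertex sum of the $m$ cycles at one common vertex), where $m\ge2$; further, let $C^1$ be a cycle of minimum length among the $m$ cycles of $B_m$. Then, for every real $k\in[1,\kappa(B_m)]$, $\dim_f^k(B_m)=k\dim_f(B_m)=km$, where $$\kappa(B_m)=\begin{cases}|V(C^1)|-1 & \text{if } C^1 \text{ is an odd cycle},\\ |V(C^1)|-2 & \text{if } C^1 \text{ is an even cycle}.\end{cases}$$
   Context: The vertex sum of cycles at one common vertex is the graph obtained from disjoint cycles (each of length at least $3$, possibly of different lengths) by choosing one vertex in each cycle and identifying all chosen vertices to a single vertex. For a finite simple connected graph $G$ with at least two vertices, $d(x,y)$ is the length of a shortest path between $x$ and $y$. For distinct $x,y\in V(G)$, let $R\{x,y\}=\{z\in V(G): d(x,z)\neq d(y,z)\}$, and let $\kappa(G)=\min\{|R\{x,y\}|: x\neq y,\ x,y\in V(G)\}$. For a function $g$ on $V(G)$ and $U\subseteq V(G)$, write $g(U)=\sum_{s\in U}g(s)$. For a real number $k\in[1,\kappa(G)]$, a function $g:V(G)\to[0,1]$ is a $k$-resolving function of $G$ if $g(R\{x,y\})\ge k$ for any two distinct vertices $x,y\in V(G)$; the fractional $k$-metric dimension is $\dim_f^k(G)=\min\{g(V(G)): g \text{ is a } k\text{-resolving function of } G\}$. The fractional metric dimension is $\dim_f(G)=\dim_f^1(G)$. *)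

theory Defs
  imports Complex_Main "Graph_Theory.Graph_Theory"
begin

text \<open>
  A finite simple graph is a \<open>'a pair_pre_digraph\<close> satisfying \<^locale>\<open>pair_graph\<close>: an
  undirected edge is represented by its two opposite arcs. The notions below are used for
  connected graphs with at least two vertices only.
\<close>

definition gdist :: "'a pair_pre_digraph \<Rightarrow> 'a \<Rightarrow> 'a \<Rightarrow> nat" where
  "gdist G x y = (LEAST n. \<exists>p. pre_digraph.apath (with_proj G) x p y \<and> length p = n)"

definition resolving_nbhd :: "'a pair_pre_digraph \<Rightarrow> 'a \<Rightarrow> 'a \<Rightarrow> 'a set" where
  "resolving_nbhd G x y = {z \<in> pverts G. gdist G x z \<noteq> gdist G y z}"

definition kappa :: "'a pair_pre_digraph \<Rightarrow> nat" where
  "kappa G = Min {card (resolving_nbhd G x y) | x y. x \<in> pverts G \<and> y \<in> pverts G \<and> x \<noteq> y}"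

definition k_resolving :: "real \<Rightarrow> 'a pair_pre_digraph \<Rightarrow> ('a \<Rightarrow> real) \<Rightarrow> bool" where
  "k_resolving k G g \<longleftrightarrow>
     (\<forall>z \<in> pverts G. 0 \<le> g z \<and> g z \<le> 1) \<and>
     (\<forall>x \<in> pverts G. \<forall>y \<in> pverts G. x \<noteq> y \<longrightarrow> k \<le> sum g (resolving_nbhd G x y))"

text \<open>
  The \<open>LEAST\<close> is over the reals: an equation \<open>frac_k_dim k G = r\<close> is provable only by showing
  that the minimum is attained. Meaningful for \<open>1 \<le> k \<le> kappa G\<close>.
\<close>

definition frac_k_dim :: "real \<Rightarrow> 'a pair_pre_digraph \<Rightarrow> real" where
  "frac_k_dim k G = (LEAST s. \<exists>g. k_resolving k G g \<and> s = sum g (pverts G))"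

definition frac_dim :: "'a pair_pre_digraph \<Rightarrow> real" where
  "frac_dim G = frac_k_dim 1 G"

definition cycle_graph :: "'a pair_pre_digraph \<Rightarrow> bool" where
  "cycle_graph G \<longleftrightarrow>
     (\<exists>n f. 3 \<le> n \<and> bij_betw f {..<n} (pverts G) \<and>
        parcs G = (\<Union>i<n. {(f i, f (Suc i mod n)), (f (Suc i mod n), f i)}))"

text \<open>
  \<open>vertex_sum I C v B\<close>: the graph \<open>B\<close> arises from the pairwise disjoint graphs \<open>C i\<close>, \<open>i \<in> I\<close>,
  by identifying the chosen vertices \<open>v i\<close>. The quotient map \<open>q\<close> into the vertices of \<open>B\<close> is
  arbitrary up to its kernel, so \<open>B\<close> is determined exactly up to isomorphism.
\<close>

definition vertex_sum ::
  "'i set \<Rightarrow> ('i \<Rightarrow> 'a pair_pre_digraph) \<Rightarrow> ('i \<Rightarrow> 'a) \<Rightarrow> 'b pair_pre_digraph \<Rightarrow> bool" where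
  "vertex_sum I C v B \<longleftrightarrow>
     (\<forall>i\<in>I. \<forall>j\<in>I. i \<noteq> j \<longrightarrow> pverts (C i) \<inter> pverts (C j) = {}) \<and>
     (\<forall>i\<in>I. v i \<in> pverts (C i)) \<and>
     (\<exists>q. (\<forall>x \<in> (\<Union>i\<in>I. pverts (C i)). \<forall>y \<in> (\<Union>i\<in>I. pverts (C i)).
             q x = q y \<longleftrightarrow> x = y \<or> (x \<in> v ` I \<and> y \<in> v ` I)) \<and>
          pverts B = q ` (\<Union>i\<in>I. pverts (C i)) \<and>
          parcs B = (\<lambda>(x, y). (q x, q y)) ` (\<Union>i\<in>I. parcs (C i)))"

definition bouquet :: "nat \<Rightarrow> (nat \<Rightarrow> 'a pair_pre_digraph) \<Rightarrow> 'b pair_pre_digraph \<Rightarrow> bool" where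
  "bouquet m C B \<longleftrightarrow> (\<forall>i\<in>{1..m}. cycle_graph (C i)) \<and> (\<exists>v. vertex_sum {1..m} C v B)"

end

theory Submission
  imports Defs
begin

text \<open>
  On each cycle \<open>C i\<close> the two neighbours of the centre are resolved exactly by the vertices of
  \<open>C i\<close> other than the centre and the antipode of the centre, if it exists. These \<open>m\<close> sets are
  disjoint, which bounds the total weight of a \<open>k\<close>-resolving function below by \<open>k m\<close>. Conversely,
  spread the weight \<open>k\<close> evenly over each of these sets. Two vertices of the same cycle at equal
  distance from the centre are resolved by the whole set of that cycle; at different distances, by
  all vertices of the other cycles. Two vertices of different cycles at different distances from
  the centre are resolved by the whole cycle of the closer one; at equal distance, each cycle
  contributes the half on the side of the given vertex, of weight \<open>k/2\<close>.
  The weights are at most 1 as long as \<open>k\<close> does not exceed the size of the smallest of the \<open>m\<close>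
  sets, hence that size is \<open>kappa\<close>.
\<close>

section \<open>Graph distance from a function that decreases towards the target\<close>

text \<open>Along an arc \<open>d\<close> drops by at most one, so every walk from \<open>x\<close>
  to \<open>y\<close> has length at least \<open>d x\<close>; following the descending arcs gives a
  path of exactly this length.\<close>

lemma gdist_eqI:
  assumes arcs: "\<And>a b. (a, b) \<in> parcs G \<Longrightarrow> d a \<le> Suc (d b) \<and> b \<in> pverts G"
    and zero: "\<And>a. a \<in> pverts G \<Longrightarrow> d a = 0 \<longleftrightarrow> a = y"
    and descent: "\<And>a. a \<in> pverts G \<Longrightarrow> 0 < d a \<Longrightarrow> \<exists>b. (a, b) \<in> parcs G \<and> Suc (d b) = d a"
    and x: "x \<in> pverts G"
  shows "gdist G x y = d x"
proof -
  interpret pair_pre_digraph G .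
  \<comment> \<open>The bound on \<open>d\<close> along the path is carried through the induction
    because it shows that prepending \<open>a\<close> repeats no vertex: all later vertices have
    smaller \<open>d\<close>.\<close>
  have ex: "\<exists>p. apath a p y \<and> length p = d a \<and> (\<forall>w \<in> set (awalk_verts a p). d w \<le> d a)"
    if "a \<in> pverts G" for a
    using that
  proof (induction "d a" arbitrary: a)
    case 0
    then have "a = y"
      using zero[of a] by simp
    then have "apath a [] y"
      using 0 by (auto simp: apath_def awalk_def)
    then show ?case
      using 0 by (intro exI[of _ "[]"]) simp
  next
    case (Suc k)
    then obtain b where b: "(a, b) \<in> parcs G" "Suc (d b) = d a"
      using descent[of a] by auto
    then have "b \<in> pverts G"
      using arcs by blast
    then obtain p where p: "apath b p y" "length p = d b" "\<forall>w \<in> set (awalk_verts b p). d w \<le> d b"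
      using Suc.hyps(1)[of b] Suc.hyps(2) b(2) by auto
    have "a \<notin> set (awalk_verts b p)"
      using p(3) b(2) by fastforce
    then have "apath a ((a, b) # p) y"
      using p(1) b(1) Suc.prems by (auto simp: apath_def awalk_def)
    then show ?case
      using p b(2) by (intro exI[of _ "(a, b) # p"]) fastforce
  qed
  have le: "d a \<le> length p" if "cas a p y" "set p \<subseteq> parcs G" "a \<in> pverts G" for a p
    using that
  proof (induction p arbitrary: a)
    case Nil
    then show ?case
      using zero[of a] by simp
  next
    case (Cons e p)
    then have "(a, snd e) \<in> parcs G"
      by (cases e) auto
    with arcs have "d a \<le> Suc (d (snd e))" "snd e \<in> pverts G"
      by auto
    with Cons show ?case
      by fastforce
  qed
  show ?thesis
    unfolding gdist_def
  proof (rule Least_equality)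
    show "\<exists>p. apath x p y \<and> length p = d x"
      using ex[OF x] by blast
    show "d x \<le> k" if "\<exists>p. apath x p y \<and> length p = k" for k
      using that le x by (auto simp: apath_def awalk_def)
  qed
qed

section \<open>Distance on a single cycle\<close>

text \<open>The term \<open>(s - t) + (t - s)\<close> is the absolute difference, by truncated subtraction.\<close>

definition cyc_dist :: "nat \<Rightarrow> nat \<Rightarrow> nat \<Rightarrow> nat" where
  "cyc_dist n s t = min ((s - t) + (t - s)) (n - ((s - t) + (t - s)))"

text \<open>Replaces \<open>min\<close> and truncated subtraction by linear constraints, so that
  later facts follow by case splits and \<open>linarith\<close>. The disjuncts record which index is
  larger and whether the direct way or the way around is shorter.\<close>

lemma cyc_dist_linear:
  assumes "s < n" "t < n"
  shows "2 * s \<le> n + 2 * t \<and> t \<le> s \<and> cyc_dist n s t + t = s \<or>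
    n + 2 * t < 2 * s \<and> cyc_dist n s t + s = n + t \<or>
    2 * t \<le> n + 2 * s \<and> s < t \<and> cyc_dist n s t + s = t \<or>
    n + 2 * s < 2 * t \<and> cyc_dist n s t + t = n + s"
  using assms unfolding cyc_dist_def by (cases "t \<le> s") (auto simp: min_def)

lemma cyc_dist_centre:
  assumes "s < n"
  shows "2 * s \<le> n \<and> cyc_dist n s 0 = s \<or> n < 2 * s \<and> cyc_dist n s 0 + s = n"
    and "cyc_dist n 0 s = cyc_dist n s 0"
  using assms by (auto simp: cyc_dist_def min_def)

lemma cyc_dist_eq_0_iff: "s < n \<Longrightarrow> t < n \<Longrightarrow> cyc_dist n s t = 0 \<longleftrightarrow> s = t"
  by (auto simp: cyc_dist_def min_def)

lemma cyc_dist_self [simp]: "cyc_dist n s s = 0"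
  by (simp add: cyc_dist_def)

lemma Suc_mod_cases:
  fixes n s :: nat
  assumes "s < n"
  shows "Suc s < n \<and> Suc s mod n = Suc s \<or> Suc s = n \<and> Suc s mod n = 0"
  using assms by (cases "Suc s = n") auto

lemma cyc_dist_step:
  assumes "s < n" "t < n"
  shows "cyc_dist n s t \<le> Suc (cyc_dist n (Suc s mod n) t)"
    and "cyc_dist n (Suc s mod n) t \<le> Suc (cyc_dist n s t)"
proof -
  have "Suc s mod n < n"
    using assms by simp
  note * = assms Suc_mod_cases[OF assms(1)] cyc_dist_linear[OF assms] cyc_dist_linear[OF this assms(2)]
  show "cyc_dist n s t \<le> Suc (cyc_dist n (Suc s mod n) t)"
    using * by - (elim disjE conjE; linarith)
  show "cyc_dist n (Suc s mod n) t \<le> Suc (cyc_dist n s t)"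
    using * by - (elim disjE conjE; linarith)
qed

lemma cyc_dist_descent:
  assumes "s < n" "t < n" "s \<noteq> t"
  shows "\<exists>s'<n. (s' = Suc s mod n \<or> s = Suc s' mod n) \<and> Suc (cyc_dist n s' t) = cyc_dist n s t"
\<comment> \<open>The case condition asks whether a shortest way from \<open>s\<close> to
  \<open>t\<close> starts by increasing the index: directly if \<open>s < t\<close>, past
  \<open>n - 1\<close> and on through 0 if \<open>t < s\<close>.\<close>
proof (cases "s < t \<and> 2 * t \<le> n + 2 * s \<or> t < s \<and> n + 2 * t < 2 * s")
  case True
  define s' where "s' = Suc s mod n"
  have s': "s' < n" "Suc s < n \<and> s' = Suc s \<or> Suc s = n \<and> s' = 0"
    using assms Suc_mod_cases by (auto simp: s'_def)
  have "Suc (cyc_dist n s' t) = cyc_dist n s t"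
    using assms True s' cyc_dist_linear[OF assms(1,2)] cyc_dist_linear[OF s'(1) assms(2)]
    by - (elim disjE conjE; linarith)
  then show ?thesis
    using s' s'_def by blast
next
  case False
  define s' where "s' = (if s = 0 then n - 1 else s - 1)"
  have s': "s' < n" "s = Suc s' mod n" "s = 0 \<and> Suc s' = n \<or> s = Suc s'"
    using assms by (auto simp: s'_def)
  have "Suc (cyc_dist n s' t) = cyc_dist n s t"
    using assms False s'(1,3) cyc_dist_linear[OF assms(1,2)] cyc_dist_linear[OF s'(1) assms(2)]
    by - (elim disjE conjE; linarith)
  then show ?thesis
    using s' by blast
qed

lemma cyc_dist_triangle:
  assumes "s < n" "u < n"
  shows "cyc_dist n s u \<le> cyc_dist n s 0 + cyc_dist n 0 u"
  using cyc_dist_linear[OF assms] cyc_dist_centre[OF assms(1)] cyc_dist_centre[OF assms(2)]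
  by - (elim disjE conjE; linarith)

text \<open>Distinct positions equally far from 0 are swapped by the reflection of the cycle that
  fixes 0. The positions equidistant from both are the fixed points of this reflection: 0 and, for
  even \<open>n\<close>, its antipode.\<close>

lemma cyc_dist_mirror:
  assumes "s < n" "t < n" "s \<noteq> t" "u < n" "cyc_dist n s 0 = cyc_dist n t 0"
  shows "cyc_dist n s u = cyc_dist n t u \<longleftrightarrow> u = 0 \<or> 2 * u = n"
proof -
  have t: "s + t = n"
    using assms(3,5) cyc_dist_centre(1)[OF assms(1)] cyc_dist_centre(1)[OF assms(2)]
    by - (elim disjE conjE; linarith)
  have "u = 0 \<or> 2 * u = n" if "cyc_dist n s u = cyc_dist n t u"
    using assms(1-4) t that cyc_dist_linear[OF assms(1,4)] cyc_dist_linear[OF assms(2,4)]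
    by - (elim disjE conjE; linarith)
  moreover have "cyc_dist n s u = cyc_dist n t u" if "u = 0 \<or> 2 * u = n"
    using assms(1-4) t that cyc_dist_linear[OF assms(1,4)] cyc_dist_linear[OF assms(2,4)]
    by - (elim disjE conjE; linarith)
  ultimately show ?thesis
    by blast
qed

section \<open>The two open halves of a cycle\<close>

text \<open>For positive \<open>n\<close>, twice this number is \<open>n - 1\<close> if
  \<open>n\<close> is odd and \<open>n - 2\<close> if \<open>n\<close> is even, which are the two
  values in the formula for \<open>kappa\<close>.\<close>

definition half :: "nat \<Rightarrow> nat" where
  "half n = (n - 1) div 2"

definition lower :: "nat \<Rightarrow> nat set" where
  "lower n = {u. 0 < u \<and> 2 * u < n}"

definition upper :: "nat \<Rightarrow> nat set" where
  "upper n = {u. n < 2 * u \<and> u < n}"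

lemma lower_eq: "lower n = {1..half n}"
  by (auto simp: lower_def half_def)

lemma upper_eq: "upper n = {n - half n..<n}"
  by (auto simp: upper_def half_def)

lemma half_props:
  shows "card (lower n) = half n" "card (upper n) = half n" "finite (lower n)" "finite (upper n)"
    and "lower n \<inter> upper n = {}" "card (lower n \<union> upper n) = 2 * half n"
proof -
  show *: "card (lower n) = half n" "card (upper n) = half n" "finite (lower n)" "finite (upper n)"
    by (auto simp: lower_eq upper_eq) (simp add: half_def)
  show "lower n \<inter> upper n = {}"
    by (auto simp: lower_def upper_def)
  with * show "card (lower n \<union> upper n) = 2 * half n"
    by (simp add: card_Un_disjoint)
qed

lemma mem_halves_iff: "u \<in> lower n \<union> upper n \<longleftrightarrow> 0 < u \<and> u < n \<and> 2 * u \<noteq> n"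
  by (auto simp: lower_def upper_def)

lemma halves_subset: "lower n \<subseteq> {0<..<n}" "upper n \<subseteq> {0<..<n}"
  by (auto simp: lower_def upper_def)

text \<open>A vertex on the same side of the centre as \<open>s\<close> is reached from \<open>s\<close> without detour
  through the centre.\<close>

lemma cyc_dist_less_same_side:
  assumes "0 < s" "s < n" and "if 2 * s \<le> n then u \<in> lower n else u \<in> upper n"
  shows "cyc_dist n s u < cyc_dist n s 0 + cyc_dist n 0 u"
proof -
  have u: "u < n" "2 * s \<le> n \<and> 0 < u \<and> 2 * u < n \<or> n < 2 * s \<and> n < 2 * u"
    using assms by (auto simp: lower_def upper_def split: if_splits)
  then show ?thesis
    using assms(1,2) cyc_dist_linear[OF assms(2) u(1)] cyc_dist_centre[OF assms(2)]
      cyc_dist_centre[OF u(1)]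
    by - (elim disjE conjE; linarith)
qed

section \<open>Coordinates on a bouquet and its distance function\<close>

text \<open>\<open>F i s\<close> is the vertex at position \<open>s\<close> of cycle
  \<open>i\<close>, and position 0 is the centre on every cycle. This hides the disjoint cycles and
  the quotient map from the metric arguments.\<close>

locale bouquet_coords =
  fixes I :: "'i set" and n :: "'i \<Rightarrow> nat" and F :: "'i \<Rightarrow> nat \<Rightarrow> 'b" and B :: "'b pair_pre_digraph"
  assumes fin: "finite I" and card_I: "2 \<le> card I"
    and n3: "\<And>i. i \<in> I \<Longrightarrow> 3 \<le> n i"
    and F_eq_iff: "\<And>i j s t. i \<in> I \<Longrightarrow> j \<in> I \<Longrightarrow> s < n i \<Longrightarrow> t < n j \<Longrightarrow>
      F i s = F j t \<longleftrightarrow> i = j \<and> s = t \<or> s = 0 \<and> t = 0"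
    and pverts_eq: "pverts B = (\<Union>i\<in>I. F i ` {..<n i})"
    and parcs_eq: "parcs B = (\<Union>i\<in>I. \<Union>s<n i.
      {(F i s, F i (Suc s mod n i)), (F i (Suc s mod n i), F i s)})"
begin

lemma n_pos [simp]: "i \<in> I \<Longrightarrow> 0 < n i"
  using n3[of i] by simp

text \<open>The centre is the only vertex with several coordinates, so a function of coordinates
  descends to the vertices once its values at position 0 agree.\<close>

lemma lift:
  assumes "\<And>i j. i \<in> I \<Longrightarrow> j \<in> I \<Longrightarrow> E i 0 = E j 0"
  obtains e where "\<And>i s. i \<in> I \<Longrightarrow> s < n i \<Longrightarrow> e (F i s) = E i s"
proof -
  define e where "e z = (SOME a. \<exists>i s. i \<in> I \<and> s < n i \<and> z = F i s \<and> a = E i s)" for z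
  have "e (F i s) = E i s" if "i \<in> I" "s < n i" for i s
    unfolding e_def
  proof (rule some_equality)
    fix a assume "\<exists>j t. j \<in> I \<and> t < n j \<and> F i s = F j t \<and> a = E j t"
    then obtain j t where "j \<in> I" "t < n j" "F i s = F j t" "a = E j t"
      by blast
    then show "a = E i s"
      using F_eq_iff[of i j s t] that assms by auto
  qed (use that in blast)
  then show thesis
    using that by blast
qed

text \<open>Paths between different cycles pass through the centre. At \<open>s = 0\<close> both
  branches give the same value, so the name chosen for the centre does not matter.\<close>

definition bdist :: "'i \<Rightarrow> nat \<Rightarrow> 'i \<Rightarrow> nat \<Rightarrow> nat" where
  "bdist i s j t =
     (if i = j then cyc_dist (n i) s t else cyc_dist (n i) s 0 + cyc_dist (n j) 0 t)"

lemma F_in_pverts: "i \<in> I \<Longrightarrow> s < n i \<Longrightarrow> F i s \<in> pverts B"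
  by (auto simp: pverts_eq)

lemma F_centre: "i \<in> I \<Longrightarrow> j \<in> I \<Longrightarrow> F i 0 = F j 0"
  by (simp add: F_eq_iff)

lemma gdist_F:
  assumes "i \<in> I" "s < n i" "j \<in> I" "t < n j"
  shows "gdist B (F i s) (F j t) = bdist i s j t"
proof -
  have "bdist i 0 j t = bdist k 0 j t" for i k
    by (simp add: bdist_def)
  then obtain e where e: "\<And>i s. i \<in> I \<Longrightarrow> s < n i \<Longrightarrow> e (F i s) = bdist i s j t"
    using lift[of "\<lambda>i s. bdist i s j t"] by blast
  have "gdist B (F i s) (F j t) = e (F i s)"
  proof (rule gdist_eqI)
    fix a b assume "(a, b) \<in> parcs B"
    then obtain k u where k: "k \<in> I" "u < n k"
      and ab: "a = F k u \<and> b = F k (Suc u mod n k) \<or> a = F k (Suc u mod n k) \<and> b = F k u"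
      by (auto simp: parcs_eq)
    have "e (F k u) \<le> Suc (e (F k (Suc u mod n k)))" "e (F k (Suc u mod n k)) \<le> Suc (e (F k u))"
      using k assms cyc_dist_step[of u "n k"] by (auto simp: e bdist_def)
    then show "e a \<le> Suc (e b) \<and> b \<in> pverts B"
      using ab k by (auto simp: F_in_pverts)
  next
    fix a assume "a \<in> pverts B"
    then obtain k u where k: "k \<in> I" "u < n k" "a = F k u"
      by (auto simp: pverts_eq)
    then show "e a = 0 \<longleftrightarrow> a = F j t"
      using assms by (auto simp: e bdist_def cyc_dist_eq_0_iff F_eq_iff)
  next
    fix a assume a: "a \<in> pverts B" "0 < e a"
    \<comment> \<open>The centre is renamed as a vertex of the target's cycle \<open>j\<close>,
      since only a step inside that cycle can lead from it towards the target.\<close>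
    obtain k u where k: "k \<in> I" "u < n k" "a = F k u" "k = j \<or> u \<noteq> 0"
    proof -
      obtain k u where k: "k \<in> I" "u < n k" "a = F k u"
        using a by (auto simp: pverts_eq)
      show thesis
      proof (cases "u = 0")
        case True
        then have "a = F j 0"
          using k F_centre assms by blast
        then show thesis
          using that[of j 0] assms by simp
      next
        case False
        then show thesis
          using that[of k u] k by blast
      qed
    qed
    \<comment> \<open>The position on cycle \<open>k\<close> to head for: the target on its own
      cycle, the centre on any other.\<close>
    define t' where "t' = (if k = j then t else 0)"
    have "t' < n k" "u \<noteq> t'"
      using k a assms by (auto simp: t'_def e bdist_def)
    then obtain u' where u': "u' < n k" "u' = Suc u mod n k \<or> u = Suc u' mod n k"
        "Suc (cyc_dist (n k) u' t') = cyc_dist (n k) u t'"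
      using cyc_dist_descent[of u "n k" t'] k by blast
    have "(a, F k u') \<in> parcs B"
      using u'(1,2) k by (auto simp: parcs_eq)
    moreover have "Suc (e (F k u')) = e a"
      using u'(1,3) k by (auto simp: e bdist_def t'_def split: if_splits)
    ultimately show "\<exists>b. (a, b) \<in> parcs B \<and> Suc (e b) = e a"
      by blast
  qed (use assms F_in_pverts in auto)
  then show ?thesis
    using e assms by simp
qed

section \<open>Resolving neighbourhoods and the lower bound on the total weight\<close>

lemma F_in_resolving_nbhd_iff:
  assumes "i \<in> I" "s < n i" "j \<in> I" "t < n j" "k \<in> I" "u < n k"
  shows "F k u \<in> resolving_nbhd B (F i s) (F j t) \<longleftrightarrow> bdist i s k u \<noteq> bdist j t k u"
  using assms by (auto simp: resolving_nbhd_def gdist_F F_in_pverts)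

lemma inj_on_F: "i \<in> I \<Longrightarrow> inj_on (F i) {..<n i}"
  by (auto simp: inj_on_def F_eq_iff)

lemma F_image_disjoint:
  assumes "i \<in> I" "j \<in> I" "i \<noteq> j" "S \<subseteq> {0<..<n i}" "T \<subseteq> {0<..<n j}"
  shows "F i ` S \<inter> F j ` T = {}"
proof -
  have "F i s \<noteq> F j t" if "s \<in> S" "t \<in> T" for s t
    using F_eq_iff[of i j s t] that assms by fastforce
  then show ?thesis
    by blast
qed

lemma finite_pverts: "finite (pverts B)"
  using fin by (simp add: pverts_eq)

lemma finite_resolving_nbhd: "finite (resolving_nbhd B x y)"
  using finite_pverts by (simp add: resolving_nbhd_def)

text \<open>The neighbours of the centre on a cycle are resolved by vertices of that cycle only.\<close>

lemma resolving_nbhd_neighbours: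
  assumes i: "i \<in> I"
  shows "resolving_nbhd B (F i 1) (F i (n i - 1)) = F i ` (lower (n i) \<union> upper (n i))"
proof -
  have n: "1 < n i" "n i - 1 < n i" "1 \<noteq> n i - 1"
    using n3[OF i] by auto
  have c: "cyc_dist (n i) 1 0 = cyc_dist (n i) (n i - 1) 0"
    using n by (auto simp: cyc_dist_def min_def)
  show ?thesis
  proof (intro set_eqI iffI)
    fix z assume z: "z \<in> resolving_nbhd B (F i 1) (F i (n i - 1))"
    then obtain k u where k: "k \<in> I" "u < n k" "z = F k u"
      by (auto simp: resolving_nbhd_def pverts_eq)
    with z have "bdist i 1 k u \<noteq> bdist i (n i - 1) k u"
      using F_in_resolving_nbhd_iff[OF i n(1) i n(2)] by simp
    \<comment> \<open>Vertices of other cycles are reached through the centre, from which both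
      neighbours are equally far by \<open>c\<close>; on cycle \<open>i\<close> the mirror lemma
      decides.\<close>
    then have "k = i" "u \<noteq> 0 \<and> 2 * u \<noteq> n i"
      using c k cyc_dist_mirror[OF n _ c, of u] by (auto simp: bdist_def split: if_splits)
    then show "z \<in> F i ` (lower (n i) \<union> upper (n i))"
      using k by (intro image_eqI[of _ _ u]) (simp_all add: mem_halves_iff del: Un_iff)
  next
    fix z assume "z \<in> F i ` (lower (n i) \<union> upper (n i))"
    then obtain u where u: "z = F i u" "0 < u \<and> u < n i \<and> 2 * u \<noteq> n i"
      using mem_halves_iff by blast
    then show "z \<in> resolving_nbhd B (F i 1) (F i (n i - 1))"
      using F_in_resolving_nbhd_iff[OF i n(1) i n(2) i, of u] cyc_dist_mirror[OF n _ c, of u]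
      by (simp add: bdist_def)
  qed
qed

lemma card_resolving_nbhd_neighbours:
  assumes "i \<in> I"
  shows "card (resolving_nbhd B (F i 1) (F i (n i - 1))) = 2 * half (n i)"
proof -
  have "lower (n i) \<union> upper (n i) \<subseteq> {..<n i}"
    by (auto simp: lower_def upper_def)
  then have "inj_on (F i) (lower (n i) \<union> upper (n i))"
    using inj_on_F[OF assms] inj_on_subset by blast
  then show ?thesis
    by (simp only: resolving_nbhd_neighbours[OF assms] card_image half_props)
qed

lemma neighbours_distinct:
  assumes "i \<in> I"
  shows "F i 1 \<in> pverts B" "F i (n i - 1) \<in> pverts B" "F i 1 \<noteq> F i (n i - 1)"
  using n3[OF assms] assms by (auto simp: F_in_pverts F_eq_iff)

lemma k_resolving_sum_ge:
  assumes g: "k_resolving k B g"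
  shows "k * card I \<le> sum g (pverts B)"
proof -
  let ?S = "\<lambda>i. F i ` (lower (n i) \<union> upper (n i))"
  have "k * card I = (\<Sum>i\<in>I. k)"
    by simp
  also have "\<dots> \<le> (\<Sum>i\<in>I. sum g (?S i))"
    using g neighbours_distinct resolving_nbhd_neighbours
    by (intro sum_mono) (metis k_resolving_def)
  also have "\<dots> = sum g (\<Union>i\<in>I. ?S i)"
    using fin F_image_disjoint halves_subset
    by (subst sum.UNION_disjoint) (auto simp: half_props)
  also have "\<dots> \<le> sum g (pverts B)"
  proof (rule sum_mono2[OF finite_pverts])
    show "(\<Union>i\<in>I. ?S i) \<subseteq> pverts B"
      using halves_subset by (fastforce simp: pverts_eq)
  qed (use g in \<open>auto simp: k_resolving_def\<close>)
  finally show ?thesis .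
qed

section \<open>The evenly spread weight function\<close>

lemma half_pos: "i \<in> I \<Longrightarrow> 0 < half (n i)"
  using n3[of i] by (simp add: half_def)

text \<open>The common value 0 at position 0 is what allows \<open>lift\<close> to transfer this to
  vertices.\<close>

definition coord_weight :: "real \<Rightarrow> 'i \<Rightarrow> nat \<Rightarrow> real" where
  "coord_weight k i u = (if u \<in> lower (n i) \<union> upper (n i) then k / (2 * half (n i)) else 0)"

text \<open>The choice operator avoids selecting a name for the centre; values off the graph are
  arbitrary.\<close>

definition weight :: "real \<Rightarrow> 'b \<Rightarrow> real" where
  "weight k = (SOME e. \<forall>i\<in>I. \<forall>u<n i. e (F i u) = coord_weight k i u)"

lemma weight_F:
  assumes "i \<in> I" "u < n i"
  shows "weight k (F i u) = coord_weight k i u"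
proof -
  have "coord_weight k i 0 = coord_weight k j 0" for i j
    by (simp add: coord_weight_def lower_def upper_def)
  then obtain e where "\<And>i s. i \<in> I \<Longrightarrow> s < n i \<Longrightarrow> e (F i s) = coord_weight k i s"
    using lift by metis
  then have "\<exists>e. \<forall>i\<in>I. \<forall>u<n i. e (F i u) = coord_weight k i u"
    by blast
  from someI_ex[OF this] show ?thesis
    using assms unfolding weight_def by blast
qed

lemma sum_weight:
  assumes i: "i \<in> I" and S: "S \<subseteq> lower (n i) \<union> upper (n i)"
  shows "sum (weight k) (F i ` S) = card S * (k / (2 * half (n i)))"
proof -
  have S': "S \<subseteq> {..<n i}"
    using S halves_subset by fastforce
  then have "sum (weight k) (F i ` S) = (\<Sum>u\<in>S. weight k (F i u))"
    using inj_on_F[OF i] by (subst sum.reindex) (auto intro: inj_on_subset)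
  also have "\<dots> = (\<Sum>u\<in>S. k / (2 * half (n i)))"
  proof (rule sum.cong)
    fix u assume "u \<in> S"
    then have "u < n i" "u \<in> lower (n i) \<union> upper (n i)"
      using S S' by auto
    then show "weight k (F i u) = k / (2 * half (n i))"
      using i by (simp only: weight_F coord_weight_def if_True)
  qed simp
  finally show ?thesis
    by simp
qed

lemma sum_weight_halves:
  assumes "i \<in> I"
  shows "sum (weight k) (F i ` lower (n i)) = k / 2" "sum (weight k) (F i ` upper (n i)) = k / 2"
    and "sum (weight k) (F i ` (lower (n i) \<union> upper (n i))) = k"
  using half_pos[OF assms] by (simp_all add: sum_weight assms half_props)

lemma weight_nonneg: "0 \<le> k \<Longrightarrow> z \<in> pverts B \<Longrightarrow> 0 \<le> weight k z"
  by (auto simp: pverts_eq weight_F coord_weight_def)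

lemma sum_weight_mono:
  assumes "0 \<le> k" "S \<subseteq> resolving_nbhd B x y"
  shows "sum (weight k) S \<le> sum (weight k) (resolving_nbhd B x y)"
  using assms finite_resolving_nbhd weight_nonneg
  by (intro sum_mono2) (auto simp: resolving_nbhd_def)

lemma sum_weight_pverts: "sum (weight k) (pverts B) = k * card I"
proof -
  let ?S = "\<lambda>i. F i ` (lower (n i) \<union> upper (n i))"
  have "sum (weight k) (pverts B) = sum (weight k) (\<Union>i\<in>I. ?S i)"
  proof (rule sum.mono_neutral_right[OF finite_pverts])
    show "(\<Union>i\<in>I. ?S i) \<subseteq> pverts B"
      using halves_subset by (fastforce simp: pverts_eq)
    show "\<forall>z\<in>pverts B - (\<Union>i\<in>I. ?S i). weight k z = 0"
    proof
      fix z assume z: "z \<in> pverts B - (\<Union>i\<in>I. ?S i)"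
      then obtain i u where i: "i \<in> I" "u < n i" "z = F i u"
        by (auto simp: pverts_eq)
      with z have "u \<notin> lower (n i) \<union> upper (n i)"
        by blast
      then show "weight k z = 0"
        using i by (simp only: weight_F coord_weight_def if_False)
    qed
  qed
  also have "\<dots> = (\<Sum>i\<in>I. sum (weight k) (?S i))"
    using fin F_image_disjoint halves_subset
    by (subst sum.UNION_disjoint) (auto simp: half_props)
  also have "\<dots> = k * card I"
    by (simp add: sum_weight_halves)
  finally show ?thesis .
qed

section \<open>Every pair of vertices is resolved with weight at least k\<close>

lemma weight_resolves_same_cycle:
  assumes k: "0 \<le> k" and i: "i \<in> I" "s < n i" "t < n i" "s \<noteq> t"
  shows "k \<le> sum (weight k) (resolving_nbhd B (F i s) (F i t))"
proof -
  obtain j where j: "j \<in> I"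
    "F j ` (lower (n j) \<union> upper (n j)) \<subseteq> resolving_nbhd B (F i s) (F i t)"
  proof (cases "cyc_dist (n i) s 0 = cyc_dist (n i) t 0")
    case True
    have "F i u \<in> resolving_nbhd B (F i s) (F i t)" if "u \<in> lower (n i) \<union> upper (n i)" for u
      using that i cyc_dist_mirror[OF i(2-4) _ True, of u] unfolding mem_halves_iff
      by (simp add: F_in_resolving_nbhd_iff bdist_def)
    then show thesis
      using that i by blast
  next
    case False
    \<comment> \<open>A second cycle exists. Seen from any of its vertices, the two distances differ
      exactly as the distances to the centre do.\<close>
    obtain j where j: "j \<in> I" "j \<noteq> i"
      using card_I by (metis One_nat_def card_le_Suc0_iff_eq fin i(1) not_less_eq_eq numeral_2_eq_2)
    have "F j u \<in> resolving_nbhd B (F i s) (F i t)" if "u \<in> lower (n j) \<union> upper (n j)" for u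
      using that i j False unfolding mem_halves_iff
      by (simp add: F_in_resolving_nbhd_iff bdist_def)
    then show thesis
      using that j by blast
  qed
  then show ?thesis
    using sum_weight_mono[OF k j(2)] by (simp add: sum_weight_halves)
qed

lemma resolving_nbhd_commute: "resolving_nbhd B x y = resolving_nbhd B y x"
  by (auto simp: resolving_nbhd_def)

text \<open>For \<open>u\<close> on the closer vertex's cycle, the triangle inequality bounds its
  distance to \<open>u\<close> by a detour through the centre, and the farther vertex must make a
  strictly longer one.\<close>

lemma weight_resolves_closer:
  assumes k: "0 \<le> k" and ij: "i \<in> I" "j \<in> I" "i \<noteq> j" "s < n i" "t < n j"
    and less: "cyc_dist (n i) s 0 < cyc_dist (n j) t 0"
  shows "k \<le> sum (weight k) (resolving_nbhd B (F i s) (F j t))"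
proof -
  have "F i u \<in> resolving_nbhd B (F i s) (F j t)" if "u < n i" for u
    using that ij less cyc_dist_triangle[of s "n i" u]
    by (simp add: F_in_resolving_nbhd_iff bdist_def)
  then have "F i ` (lower (n i) \<union> upper (n i)) \<subseteq> resolving_nbhd B (F i s) (F j t)"
    unfolding lower_def upper_def by auto
  from sum_weight_mono[OF k this] show ?thesis
    using ij by (simp add: sum_weight_halves)
qed

text \<open>The antipode of the centre could be assigned to either half; the lower one is
  chosen.\<close>

definition side :: "'i \<Rightarrow> nat \<Rightarrow> nat set" where
  "side i s = (if 2 * s \<le> n i then lower (n i) else upper (n i))"

text \<open>From \<open>F j t\<close> the way to this side leads through the centre, whereas
  \<open>F i s\<close>, equally far from the centre, has a strictly shorter way within its own
  cycle.\<close>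

lemma side_subset_resolving:
  assumes ij: "i \<in> I" "j \<in> I" "i \<noteq> j" "s < n i" "t < n j" "0 < s"
    and eq: "cyc_dist (n i) s 0 = cyc_dist (n j) t 0"
  shows "F i ` side i s \<subseteq> resolving_nbhd B (F i s) (F j t)"
proof -
  have "F i u \<in> resolving_nbhd B (F i s) (F j t)" if u: "u \<in> side i s" for u
  proof -
    have "u < n i"
      using u by (auto simp: side_def lower_def upper_def split: if_splits)
    moreover have "cyc_dist (n i) s u < cyc_dist (n i) s 0 + cyc_dist (n i) 0 u"
      using u ij by (intro cyc_dist_less_same_side) (auto simp: side_def)
    ultimately show ?thesis
      using ij eq by (simp add: F_in_resolving_nbhd_iff bdist_def)
  qed
  then show ?thesis
    by blast
qed

lemma weight_resolves:
  assumes k: "0 \<le> k" and xy: "x \<in> pverts B" "y \<in> pverts B" "x \<noteq> y"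
  shows "k \<le> sum (weight k) (resolving_nbhd B x y)"
proof -
  obtain i s where i: "i \<in> I" "s < n i" "x = F i s"
    using xy(1) by (auto simp: pverts_eq)
  obtain j t where j: "j \<in> I" "t < n j" "y = F j t"
    using xy(2) by (auto simp: pverts_eq)
  \<comment> \<open>The centre lies on every cycle, so a pair containing it is treated as a pair on
    the cycle of the other vertex.\<close>
  consider "i = j" | "i \<noteq> j" "s = 0" | "i \<noteq> j" "t = 0" | "i \<noteq> j" "0 < s" "0 < t"
    by auto
  then show ?thesis
  proof cases
    case 1
    then show ?thesis
      using weight_resolves_same_cycle[of k i s t] k i j xy by auto
  next
    case 2
    then have "x = F j 0"
      using i j F_centre by blast
    then show ?thesis
      using weight_resolves_same_cycle[of k j 0 t] k j xy by auto
  next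
    case 3
    then have "y = F i 0"
      using i j F_centre by blast
    then show ?thesis
      using weight_resolves_same_cycle[of k i s 0] k i xy by auto
  next
    case 4
    consider "cyc_dist (n i) s 0 < cyc_dist (n j) t 0" | "cyc_dist (n j) t 0 < cyc_dist (n i) s 0"
      | (eq) "cyc_dist (n i) s 0 = cyc_dist (n j) t 0"
      by linarith
    then show ?thesis
    proof cases
      case 1
      then show ?thesis
        using weight_resolves_closer[of k i j s t] k i j 4 by simp
    next
      case 2
      then show ?thesis
        using weight_resolves_closer[of k j i t s] k i j 4 resolving_nbhd_commute[of x y] by simp
    next
      case eq
      have "F i ` side i s \<subseteq> resolving_nbhd B x y"
        using side_subset_resolving[of i j s t] eq 4 i j by simp
      moreover have "F j ` side j t \<subseteq> resolving_nbhd B y x"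
        using side_subset_resolving[of j i t s] eq 4 i j by simp
      ultimately have "F i ` side i s \<union> F j ` side j t \<subseteq> resolving_nbhd B x y"
        by (simp add: resolving_nbhd_commute[of y x])
      then have "sum (weight k) (F i ` side i s \<union> F j ` side j t)
          \<le> sum (weight k) (resolving_nbhd B x y)"
        by (rule sum_weight_mono[OF k])
      moreover have "F i ` side i s \<inter> F j ` side j t = {}"
        using i j 4 halves_subset by (intro F_image_disjoint) (auto simp: side_def)
      then have "sum (weight k) (F i ` side i s \<union> F j ` side j t) =
          sum (weight k) (F i ` side i s) + sum (weight k) (F j ` side j t)"
        by (intro sum.union_disjoint) (auto simp: side_def half_props)
      moreover have "\<dots> = k"
        using i j by (simp add: side_def sum_weight_halves)
      ultimately show ?thesis
        by simp
    qed
  qed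
qed

lemma weight_le_1:
  fixes k :: real
  assumes "\<And>i. i \<in> I \<Longrightarrow> k \<le> 2 * half (n i)" "z \<in> pverts B"
  shows "weight k z \<le> 1"
proof -
  obtain i s where i: "i \<in> I" "s < n i" "z = F i s"
    using assms(2) by (auto simp: pverts_eq)
  then have "k / (2 * half (n i)) \<le> 1"
    using assms(1)[of i] half_pos[of i] by simp
  then show ?thesis
    using i by (simp add: weight_F coord_weight_def)
qed

section \<open>Values of kappa and of the fractional dimension, with c a shortest cycle\<close>

context
  fixes c
  assumes c: "c \<in> I" and min_c: "\<And>i. i \<in> I \<Longrightarrow> n c \<le> n i"
begin

lemma half_mono: "i \<in> I \<Longrightarrow> half (n c) \<le> half (n i)"
  using min_c[of i] by (simp add: half_def div_le_mono)

lemma k_resolving_weight: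
  fixes k :: real
  assumes "0 \<le> k" "k \<le> 2 * half (n c)"
  shows "k_resolving k B (weight k)"
  unfolding k_resolving_def
proof (intro conjI ballI impI)
  have "k \<le> 2 * half (n i)" if "i \<in> I" for i
  proof -
    have "real (2 * half (n c)) \<le> real (2 * half (n i))"
      using half_mono[OF that] by simp
    then show ?thesis
      using assms(2) by linarith
  qed
  then show "weight k z \<le> 1" if "z \<in> pverts B" for z
    using weight_le_1 that by blast
qed (use assms weight_nonneg weight_resolves in auto)

text \<open>A \<open>k\<close>-resolving function, having values in the unit interval, witnesses \<open>k \<le> kappa B\<close>.\<close>

lemma kappa_eq: "kappa B = 2 * half (n c)"
  unfolding kappa_def
proof (rule Min_eqI)
  let ?K = "{card (resolving_nbhd B x y) | x y. x \<in> pverts B \<and> y \<in> pverts B \<and> x \<noteq> y}"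
  have "?K \<subseteq> (\<lambda>(x, y). card (resolving_nbhd B x y)) ` (pverts B \<times> pverts B)"
    by auto
  then show "finite ?K"
    using finite_pverts finite_subset by blast
  show "2 * half (n c) \<in> ?K"
    using neighbours_distinct[OF c] card_resolving_nbhd_neighbours[OF c, symmetric] by blast
  fix a assume "a \<in> ?K"
  then obtain x y where a: "a = card (resolving_nbhd B x y)"
    and xy: "x \<in> pverts B" "y \<in> pverts B" "x \<noteq> y"
    by blast
  \<comment> \<open>The largest \<open>k\<close> for which \<open>weight k\<close> has values at
    most 1; the value 1 is reached on the halves of the shortest cycle.\<close>
  let ?k = "real (2 * half (n c))"
  have g: "k_resolving ?k B (weight ?k)"
    by (rule k_resolving_weight) simp_all
  then have "?k \<le> sum (weight ?k) (resolving_nbhd B x y)"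
    using xy unfolding k_resolving_def by blast
  also have "\<dots> \<le> (\<Sum>z\<in>resolving_nbhd B x y. 1)"
    using g by (intro sum_mono) (auto simp: k_resolving_def resolving_nbhd_def)
  finally show "2 * half (n c) \<le> a"
    by (simp add: a flip: of_nat_mult)
qed

text \<open>\<open>weight k\<close> attains the lower bound of \<open>k_resolving_sum_ge\<close>, so
  the minimum exists, as \<open>LEAST\<close> over the reals requires.\<close>

lemma frac_k_dim_eq:
  fixes k :: real
  assumes "0 \<le> k" "k \<le> kappa B"
  shows "frac_k_dim k B = k * card I"
  unfolding frac_k_dim_def
proof (rule Least_equality)
  have "k_resolving k B (weight k)"
    using k_resolving_weight assms kappa_eq by simp
  then show "\<exists>g. k_resolving k B g \<and> k * card I = sum g (pverts B)"
    using sum_weight_pverts by metis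
qed (use k_resolving_sum_ge in blast)

end

end

section \<open>Existence of coordinates on a bouquet\<close>

text \<open>Rotating the given numbering by the index of \<open>v\<close> commutes with the cyclic
  successor, so it preserves the description of the arcs.\<close>

lemma cycle_graph_rooted:
  assumes "cycle_graph G" "v \<in> pverts G"
  defines "n \<equiv> card (pverts G)"
  obtains f where "3 \<le> n" "bij_betw f {..<n} (pverts G)" "f 0 = v"
    "parcs G = (\<Union>i<n. {(f i, f (Suc i mod n)), (f (Suc i mod n), f i)})"
proof -
  obtain n' f where n': "3 \<le> n'" and f: "bij_betw f {..<n'} (pverts G)"
    and arcs: "parcs G = (\<Union>i<n'. {(f i, f (Suc i mod n')), (f (Suc i mod n'), f i)})"
    using assms(1) by (auto simp: cycle_graph_def)
  have n: "n' = n"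
    using bij_betw_same_card[OF f] by (simp add: n_def)
  have "v \<in> f ` {..<n}"
    using f assms(2) n by (simp add: bij_betw_def)
  then obtain a where a: "a < n" "f a = v"
    by auto
  define r where "r s = (a + s) mod n" for s
  have "inj_on r {..<n}"
  proof (rule inj_onI)
    fix s t assume st: "s \<in> {..<n}" "t \<in> {..<n}" "r s = r t"
    \<comment> \<open>The sum wraps around at most once, which turns injectivity of the rotation
      into linear arithmetic.\<close>
    have r: "r u = a + u \<and> a + u < n \<or> r u + n = a + u \<and> r u < a" if "u < n" for u
      using that a by (cases "a + u < n") (auto simp: r_def le_mod_geq)
    have "s < n" "t < n"
      using st by simp_all
    from r[OF this(1)] r[OF this(2)] st(3) show "s = t"
      by (elim disjE conjE; linarith)
  qed
  moreover have "r ` {..<n} \<subseteq> {..<n}"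
    using a by (auto simp: r_def)
  ultimately have r: "bij_betw r {..<n} {..<n}"
    by (simp add: bij_betw_def endo_inj_surj)
  have rS: "r (Suc s mod n) = Suc (r s) mod n" for s
    by (simp add: r_def mod_add_right_eq mod_Suc_eq)
  have "parcs G = (\<Union>i\<in>r ` {..<n}. {(f i, f (Suc i mod n)), (f (Suc i mod n), f i)})"
    using arcs unfolding n bij_betw_imp_surj_on[OF r] .
  then have "parcs G = (\<Union>i<n. {((f \<circ> r) i, (f \<circ> r) (Suc i mod n)),
      ((f \<circ> r) (Suc i mod n), (f \<circ> r) i)})"
    by (simp only: UN_simps o_apply rS)
  moreover have "bij_betw (f \<circ> r) {..<n} (pverts G)"
    using bij_betw_trans[OF r] f n by simp
  moreover have "(f \<circ> r) 0 = v"
    using a by (simp add: r_def)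
  ultimately show thesis
    using that[of "f \<circ> r"] n' n by simp
qed

text \<open>Each cycle is numbered from its chosen vertex and then mapped by the quotient map. The
  vertices that get identified are then exactly those at position 0.\<close>

lemma bouquet_coords_exist:
  assumes m: "2 \<le> m" and B: "bouquet m C B"
  shows "\<exists>F. bouquet_coords {1..m} (\<lambda>i. card (pverts (C i))) F B"
proof -
  define n where "n i = card (pverts (C i))" for i
  let ?I = "{1..m}" let ?V = "\<Union>i\<in>?I. pverts (C i)"
  obtain v where "vertex_sum ?I C v B"
    using B unfolding bouquet_def by (elim conjE exE)
  then obtain q where disj: "\<forall>i\<in>?I. \<forall>j\<in>?I. i \<noteq> j \<longrightarrow> pverts (C i) \<inter> pverts (C j) = {}"
    and v: "\<forall>i\<in>?I. v i \<in> pverts (C i)"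
    and q: "\<forall>x\<in>?V. \<forall>y\<in>?V. q x = q y \<longleftrightarrow> x = y \<or> (x \<in> v ` ?I \<and> y \<in> v ` ?I)"
    and pv: "pverts B = q ` ?V"
    and pa: "parcs B = (\<lambda>(x, y). (q x, q y)) ` (\<Union>i\<in>?I. parcs (C i))"
    unfolding vertex_sum_def by (elim conjE exE)
  have "\<exists>f. 3 \<le> n i \<and> bij_betw f {..<n i} (pverts (C i)) \<and> f 0 = v i \<and>
      parcs (C i) = (\<Union>s<n i. {(f s, f (Suc s mod n i)), (f (Suc s mod n i), f s)})"
    if "i \<in> ?I" for i
  proof -
    have "cycle_graph (C i)" "v i \<in> pverts (C i)"
      using B v that by (auto simp: bouquet_def)
    then show ?thesis
      by (rule cycle_graph_rooted) (auto simp: n_def)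
  qed
  then have "\<forall>i\<in>?I. \<exists>f. 3 \<le> n i \<and> bij_betw f {..<n i} (pverts (C i)) \<and> f 0 = v i \<and>
      parcs (C i) = (\<Union>s<n i. {(f s, f (Suc s mod n i)), (f (Suc s mod n i), f s)})"
    by (rule ballI)
  from bchoice[OF this] obtain f where f: "\<And>i. i \<in> ?I \<Longrightarrow> 3 \<le> n i \<and> bij_betw (f i) {..<n i} (pverts (C i)) \<and>
      f i 0 = v i \<and>
      parcs (C i) = (\<Union>s<n i. {(f i s, f i (Suc s mod n i)), (f i (Suc s mod n i), f i s)})"
    by blast
  have mem: "f i s \<in> pverts (C i)" if "i \<in> ?I" "s < n i" for i s
    using f[of i] that by (auto simp: bij_betw_def)
  have eq: "f i s = f j t \<longleftrightarrow> i = j \<and> s = t" if "i \<in> ?I" "j \<in> ?I" "s < n i" "t < n j" for i j s t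
  proof (cases "i = j")
    case True
    then show ?thesis
      using f[of i] that by (auto simp: bij_betw_def inj_on_def)
  next
    case False
    then have "pverts (C i) \<inter> pverts (C j) = {}"
      using disj that by blast
    then show ?thesis
      using False mem[of i s] mem[of j t] that by auto
  qed
  have root: "f i s \<in> v ` ?I \<longleftrightarrow> s = 0" if "i \<in> ?I" "s < n i" for i s
  proof
    assume "f i s \<in> v ` ?I"
    then obtain j where j: "j \<in> ?I" "f i s = f j 0"
      using f by fastforce
    then show "s = 0"
      using eq[of i j s 0] f[of j] that by simp
  next
    assume "s = 0"
    then show "f i s \<in> v ` ?I"
      using f[of i] that by auto
  qed
  have "bouquet_coords ?I n (\<lambda>i s. q (f i s)) B"
  proof
    show "q (f i s) = q (f j t) \<longleftrightarrow> i = j \<and> s = t \<or> s = 0 \<and> t = 0"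
      if "i \<in> ?I" "j \<in> ?I" "s < n i" "t < n j" for i j s t
    proof -
      have "f i s \<in> ?V" "f j t \<in> ?V"
        using mem that by blast+
      then have "q (f i s) = q (f j t) \<longleftrightarrow> f i s = f j t \<or> (f i s \<in> v ` ?I \<and> f j t \<in> v ` ?I)"
        using q by blast
      then show ?thesis
        using eq root that by simp
    qed
    have "pverts (C i) = f i ` {..<n i}" if "i \<in> ?I" for i
      using f[OF that] by (simp add: bij_betw_def)
    then have "?V = (\<Union>i\<in>?I. f i ` {..<n i})"
      by (intro SUP_cong) auto
    then show "pverts B = (\<Union>i\<in>?I. (\<lambda>s. q (f i s)) ` {..<n i})"
      by (simp add: pv image_UN image_image)
    have "(\<Union>i\<in>?I. parcs (C i)) = (\<Union>i\<in>?I. \<Union>s<n i.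
        {(f i s, f i (Suc s mod n i)), (f i (Suc s mod n i), f i s)})"
      using f by (intro SUP_cong) auto
    then show "parcs B = (\<Union>i\<in>?I. \<Union>s<n i. {(q (f i s), q (f i (Suc s mod n i))),
        (q (f i (Suc s mod n i)), q (f i s))})"
      by (simp add: pa image_UN)
  qed (use m f in auto)
  then show ?thesis
    unfolding n_def by blast
qed

section \<open>Transfer to the bouquet\<close>

theorem proposition4p11:
  fixes m :: nat
    and C :: "nat \<Rightarrow> 'a pair_pre_digraph"
    and B :: "'b pair_pre_digraph"
  assumes "2 \<le> m"
    and "bouquet m C B"
    and "\<forall>i\<in>{1..m}. card (pverts (C 1)) \<le> card (pverts (C i))"
  shows "kappa B = (if odd (card (pverts (C 1))) then card (pverts (C 1)) - 1
                    else card (pverts (C 1)) - 2) \<and>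
         (\<forall>k::real. 1 \<le> k \<and> k \<le> real (kappa B) \<longrightarrow>
            frac_k_dim k B = k * frac_dim B \<and> k * frac_dim B = k * real m)"
proof -
  let ?n = "\<lambda>i. card (pverts (C i))"
  obtain F where "bouquet_coords {1..m} ?n F B"
    using bouquet_coords_exist assms(1,2) by blast
  then interpret bouquet_coords "{1..m}" ?n F B .
  have 1: "1 \<in> {1..m}"
    using assms(1) by simp
  have dim: "frac_k_dim k B = k * real m" if "1 \<le> k" "k \<le> real (kappa B)" for k
    using frac_k_dim_eq[OF 1, of k] assms(3) that by simp
  have kappa: "kappa B = 2 * half (?n 1)"
    using kappa_eq[OF 1] assms(3) by blast
  also have "\<dots> = (if odd (?n 1) then ?n 1 - 1 else ?n 1 - 2)"
    using n3[OF 1] unfolding half_def by (cases "odd (?n 1)") (auto elim!: oddE evenE)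
  finally have kappa_cases: "kappa B = (if odd (?n 1) then ?n 1 - 1 else ?n 1 - 2)" .
  \<comment> \<open>This makes \<open>k = 1\<close> admissible, so that \<open>frac_dim B\<close> is
    an instance of \<open>dim\<close>.\<close>
  have "1 \<le> real (kappa B)"
    using kappa half_pos[OF 1] by simp
  then have "frac_dim B = real m"
    unfolding frac_dim_def using dim[of 1] by simp
  with kappa_cases dim show ?thesis
    by (intro conjI allI impI) simp_all
qed

end
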